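(* Let $p$ be an odd prime, let $G=UT(4,p)$, let $$\mathcal L_0^*=\{(a,b,c,0,e,f):(a,f)\in \mathbb F_p^2\setminus\{(0,0)\},\ b,c,e\in\mathbb F_p\}\subset G,$$ and choose $\eta\in \mathbb F_p$ such that $-\eta$ is a nonsquare in $\mathbb F_p$. For each $(\alpha,\beta)\in\mathbb F_p^2$, define $$K_{\alpha,\beta}=\left\{(a,\alpha a+\beta f,c,0,\eta\beta a-\alpha f,f):(a,f)\in \mathbb F_p^2\setminus\{(0,0)\},\ c\in \mathbb F_p\right\}.$$ Then: (1) each $K_{\alpha,\beta}$ is a clique in $\Gamma[\mathcal L_0^*]$; (2) the family $\{K_{\alpha,\beta}:(\alpha,\beta)\in\mathbb F_p^2\}$ is pairwise disjoint; (3) these cliques cover $\mathcal L_0^*$. Hence $\mathcal L_0^*=\bigsqcup_{(\alpha,\beta)\in\mathbb F_p^2} K_{\alpha,\beta}$ (disjoint union). Moreover, each clique has size $|K_{\alpha,\beta}|=p^3-p$.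
   Context: For a prime $p$, $UT(4,p)$ is the group, under matrix multiplication, of all $4\times 4$ upper triangular matrices over $\mathbb{F}_p$ with all diagonal entries equal to $1$. The $6$-tuple $(a,b,c,d,e,f)\in\mathbb{F}_p^6$ denotes the matrix $\begin{pmatrix}1&a&b&c\\0&1&d&e\\0&0&1&f\\0&0&0&1\end{pmatrix}$. The commuting graph $\Gamma(G)$ has vertex set $G$, two distinct vertices $x,y$ being adjacent if and only if $xy=yx$. For a subset $S\subseteq G$, $\Gamma[S]$ denotes the subgraph of $\Gamma(G)$ induced on $S$. A clique is a set of pairwise adjacent vertices. *)

theory Defs
  imports
    "HOL-Library.Disjoint_Sets"
    "HOL-Computational_Algebra.Nth_Powers"
    "Jordan_Normal_Form.Matrix"
    "Berlekamp_Zassenhaus.Finite_Field"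
    "Graph_Theory.Digraph_Component"
begin

(* The field F_p is 'p mod_ring (the integers modulo CARD('p)), where 'p is a type of prime
   cardinality p. *)

definition UT :: "nat \<Rightarrow> 'a :: comm_ring_1 mat monoid" where
  "UT n = \<lparr>carrier = {A \<in> carrier_mat n n. upper_triangular A \<and> (\<forall>i<n. A $$ (i, i) = 1)},
           monoid.mult = (*),
           one = 1\<^sub>m n\<rparr>"

definition tuple_mat :: "'a \<Rightarrow> 'a \<Rightarrow> 'a \<Rightarrow> 'a \<Rightarrow> 'a \<Rightarrow> 'a \<Rightarrow> 'a :: comm_ring_1 mat" where
  "tuple_mat a b c d e f = mat_of_rows_list 4
     [[1, a, b, c],
      [0, 1, d, e],
      [0, 0, 1, f],
      [0, 0, 0, 1]]"

lemma tuple_mat_carrier: "tuple_mat a b c d e f \<in> carrier (UT 4)"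
  by (auto simp: UT_def tuple_mat_def mat_of_rows_list_def upper_triangular_def less_Suc_eq numeral_eq_Suc)

lemma tuple_mat_mult: "tuple_mat a b c d e f * tuple_mat a' b' c' d' e' f' =
  tuple_mat (a + a') (b + b' + a * d') (c + c' + a * e' + b * f') (d + d') (e + e' + d * f') (f + f')"
  by (rule eq_matI) (auto simp: tuple_mat_def mat_of_rows_list_def scalar_prod_def less_Suc_eq numeral_eq_Suc algebra_simps)

lemma carrier_UT4: "carrier (UT 4 :: 'a :: comm_ring_1 mat monoid) = {tuple_mat a b c d e f | a b c d e f. True}"
proof
  show "{tuple_mat a b c d e f | a b c d e f. True} \<subseteq> carrier (UT 4)"
    using tuple_mat_carrier by auto
  show "carrier (UT 4 :: 'a mat monoid) \<subseteq> {tuple_mat a b c d e f | a b c d e f. True}"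
  proof
    fix A :: "'a mat" assume A: "A \<in> carrier (UT 4)"
    have "A = tuple_mat (A$$(0,1)) (A$$(0,2)) (A$$(0,3)) (A$$(1,2)) (A$$(1,3)) (A$$(2,3))"
      using A by (intro eq_matI) (auto simp: UT_def tuple_mat_def mat_of_rows_list_def upper_triangular_def less_Suc_eq numeral_eq_Suc)
    then show "A \<in> {tuple_mat a b c d e f | a b c d e f. True}" by blast
  qed
qed

lemma tuple_mat_one: "tuple_mat 0 0 0 0 0 0 = 1\<^sub>m 4"
  by (rule eq_matI) (auto simp: tuple_mat_def mat_of_rows_list_def less_Suc_eq numeral_eq_Suc)

lemma group_UT4: "group (UT 4 :: 'a::comm_ring_1 mat monoid)"
proof (rule groupI)
  fix x :: "'a mat" assume "x \<in> carrier (UT 4)"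
  then obtain a b c d e f where x: "x = tuple_mat a b c d e f" unfolding carrier_UT4 by blast
  let ?y = "tuple_mat (-a) (a*d - b) (a*e + b*f - c - a*d*f) (-d) (d*f - e) (-f)"
  have "?y * x = 1\<^sub>m 4" unfolding x tuple_mat_mult tuple_mat_one[symmetric] by (simp add: algebra_simps)
  then show "\<exists>y\<in>carrier (UT 4). y \<otimes>\<^bsub>UT 4\<^esub> x = \<one>\<^bsub>UT 4\<^esub>"
    by (intro bexI[of _ ?y] tuple_mat_carrier) (simp add: UT_def)
next
  fix x y :: "'a mat" assume "x \<in> carrier (UT 4)" "y \<in> carrier (UT 4)"
  then show "x \<otimes>\<^bsub>UT 4\<^esub> y \<in> carrier (UT 4)"
    unfolding carrier_UT4 by (auto simp: UT_def tuple_mat_mult) blast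
next
  show "\<one>\<^bsub>UT 4\<^esub> \<in> carrier (UT 4 :: 'a mat monoid)"
    using tuple_mat_carrier[of 0 0 0 0 0 0, unfolded tuple_mat_one] by (simp add: UT_def)
qed (auto simp: UT_def)

(* As usual in Graph_Theory, a simple graph is a loop-free symmetric digraph; an undirected edge
   is represented by its two orientations. *)
definition commuting_graph :: "('a, 'm) monoid_scheme \<Rightarrow> ('a, 'a \<times> 'a) pre_digraph" where
  "commuting_graph G = \<lparr>verts = carrier G,
     arcs = {(x, y). x \<in> carrier G \<and> y \<in> carrier G \<and> x \<noteq> y \<and> x \<otimes>\<^bsub>G\<^esub> y = y \<otimes>\<^bsub>G\<^esub> x},
     tail = fst,
     head = snd\<rparr>"

definition clique :: "('a, 'b) pre_digraph \<Rightarrow> 'a set \<Rightarrow> bool" where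
  "clique H C \<longleftrightarrow> C \<subseteq> verts H \<and> (\<forall>x\<in>C. \<forall>y\<in>C. x \<noteq> y \<longrightarrow> x \<rightarrow>\<^bsub>H\<^esub> y)"

definition L0star :: "'p :: prime_card mod_ring mat set" where
  "L0star = {tuple_mat a b c 0 e f | a b c e f. (a, f) \<noteq> (0, 0)}"

lemma L0star_subset: "L0star \<subseteq> carrier (UT 4)"
  using tuple_mat_carrier by (auto simp: L0star_def)

definition K :: "'p :: prime_card mod_ring \<Rightarrow> 'p mod_ring \<Rightarrow> 'p mod_ring \<Rightarrow> 'p mod_ring mat set" where
  "K \<eta> \<alpha> \<beta> = {tuple_mat a (\<alpha> * a + \<beta> * f) c 0 (\<eta> * \<beta> * a - \<alpha> * f) f | a c f. (a, f) \<noteq> (0, 0)}"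

end

theory Submission
  imports Defs
begin

text \<open>
  Two elements of \<open>UT(4,p)\<close> with middle entry \<open>d = 0\<close> commute exactly when
  \<open>a e' + b f' = a' e + b' f\<close>, since their products can differ only in the corner entry.
  On \<open>K \<eta> \<alpha> \<beta>\<close> the pair \<open>(b, e)\<close> is the linear function
  \<open>(\<alpha> a + \<beta> f, \<eta> \<beta> a - \<alpha> f)\<close> of \<open>(a, f)\<close>; substituting it turns
  \<open>a e' + b f'\<close> into \<open>\<beta> (\<eta> a a' + f f')\<close>, which is symmetric, so these sets
  are cliques.

  For the partition, fix \<open>(a, f) \<noteq> (0, 0)\<close> and read the defining equations as a linear system
  for \<open>(\<alpha>, \<beta>)\<close>. Its determinant is \<open>\<eta> a\<^sup>2 + f\<^sup>2\<close>, a binary quadratic form that has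
  no nontrivial zero because \<open>-\<eta>\<close> is a nonsquare. Hence each \<open>(b, e)\<close> comes from exactly one
  \<open>(\<alpha>, \<beta>)\<close>: existence gives the covering, uniqueness the disjointness. Finally, an element
  of \<open>K \<eta> \<alpha> \<beta>\<close> is determined by \<open>(a, f) \<noteq> (0, 0)\<close> and a free \<open>c\<close>, which
  gives \<open>(p\<^sup>2 - 1) p\<close> elements.
\<close>

lemma tuple_mat_inject:
  "tuple_mat a b c d e f = tuple_mat a' b' c' d' e' f' \<longleftrightarrow>
   a = a' \<and> b = b' \<and> c = c' \<and> d = d' \<and> e = e' \<and> f = f'"
proof
  let ?A = "tuple_mat a b c d e f" and ?A' = "tuple_mat a' b' c' d' e' f'"
  assume "?A = ?A'"
  then have "?A $$ (i, j) = ?A' $$ (i, j)" for i j by simp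
  from this[of 0 1] this[of 0 2] this[of 0 3] this[of 1 2] this[of 1 3] this[of 2 3]
  show "a = a' \<and> b = b' \<and> c = c' \<and> d = d' \<and> e = e' \<and> f = f'"
    by (simp add: tuple_mat_def mat_of_rows_list_def numeral_eq_Suc)
qed simp

lemma tuple_mat_commute_iff:
  "tuple_mat a b c 0 e f * tuple_mat a' b' c' 0 e' f' =
     tuple_mat a' b' c' 0 e' f' * tuple_mat a b c 0 e f \<longleftrightarrow>
   a * e' + b * f' = a' * e + b' * f"
  by (simp add: tuple_mat_mult tuple_mat_inject ac_simps)

lemma tuple_mat_mem_K_iff:
  "tuple_mat a b c 0 e f \<in> K \<eta> \<alpha> \<beta> \<longleftrightarrow>
   (a, f) \<noteq> (0, 0) \<and> \<alpha> * a + \<beta> * f = b \<and> \<eta> * \<beta> * a - \<alpha> * f = e"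
  by (auto simp: K_def tuple_mat_inject)

lemma K_subset_L0star: "K \<eta> \<alpha> \<beta> \<subseteq> L0star"
  unfolding K_def L0star_def by blast

lemma K_commute:
  assumes "x \<in> K \<eta> \<alpha> \<beta>" and "y \<in> K \<eta> \<alpha> \<beta>"
  shows "x * y = y * x"
  using assms by (auto simp: K_def tuple_mat_commute_iff algebra_simps)

lemma clique_induced_commuting_graphI:
  assumes "C \<subseteq> S" and "S \<subseteq> carrier G"
    and "\<And>x y. x \<in> C \<Longrightarrow> y \<in> C \<Longrightarrow> x \<otimes>\<^bsub>G\<^esub> y = y \<otimes>\<^bsub>G\<^esub> x"
  shows "clique (commuting_graph G \<restriction> S) C"
proof -
  have "x \<rightarrow>\<^bsub>commuting_graph G \<restriction> S\<^esub> y" if "x \<in> C" "y \<in> C" "x \<noteq> y" for x y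
  proof -
    have "(x, y) \<in> arcs (commuting_graph G \<restriction> S)"
      using that assms by (auto simp: commuting_graph_def induce_subgraph_def)
    then show ?thesis
      by (force simp: arcs_ends_def arc_to_ends_def commuting_graph_def induce_subgraph_def)
  qed
  then show ?thesis
    using assms(1) by (auto simp: clique_def induce_subgraph_def)
qed

text \<open>A zero with \<open>a \<noteq> 0\<close> would exhibit \<open>-\<eta>\<close> as the square of \<open>f / a\<close>,
  and one with \<open>a = 0\<close> forces \<open>f = 0\<close>.\<close>

lemma nonsquare_form_anisotropic:
  fixes \<eta> a f :: "'a :: field"
  assumes "\<not> is_square (- \<eta>)" and "(a, f) \<noteq> (0, 0)"
  shows "\<eta> * a\<^sup>2 + f\<^sup>2 \<noteq> 0"
proof
  assume zero: "\<eta> * a\<^sup>2 + f\<^sup>2 = 0"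
  have "a \<noteq> 0"
    using zero assms(2) by auto
  moreover have "f\<^sup>2 = - \<eta> * a\<^sup>2"
    using zero by (simp add: eq_neg_iff_add_eq_0 add.commute)
  ultimately have "- \<eta> = (f / a)\<^sup>2"
    by (simp add: power_divide)
  then show False
    using assms(1) by (metis is_nth_power_def)
qed

text \<open>Cramer's rule for the equations that define \<open>K\<close>, whose determinant is the
  anisotropic form above.\<close>

lemma K_parameters_unique:
  fixes \<eta> a f b e :: "'a :: field"
  assumes "\<not> is_square (- \<eta>)" and "(a, f) \<noteq> (0, 0)"
  shows "\<alpha> * a + \<beta> * f = b \<and> \<eta> * \<beta> * a - \<alpha> * f = e \<longleftrightarrow>
         \<alpha> = (\<eta> * a * b - f * e) / (\<eta> * a\<^sup>2 + f\<^sup>2) \<and> \<beta> = (f * b + a * e) / (\<eta> * a\<^sup>2 + f\<^sup>2)"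
    (is "?sys \<longleftrightarrow> ?sol")
proof
  define D where "D = \<eta> * a\<^sup>2 + f\<^sup>2"
  have D: "D \<noteq> 0"
    using nonsquare_form_anisotropic[OF assms] by (simp add: D_def)
  show ?sol if ?sys
  proof -
    have b: "b = \<alpha> * a + \<beta> * f" and e: "e = \<eta> * \<beta> * a - \<alpha> * f"
      using that by simp_all
    have "\<alpha> * D = \<eta> * a * b - f * e" "\<beta> * D = f * b + a * e"
      unfolding b e by (simp_all add: D_def power2_eq_square algebra_simps)
    with D show ?thesis
      by (simp add: D_def[symmetric] eq_divide_eq)
  qed
  show ?sys if ?sol
  proof -
    have \<alpha>\<beta>: "\<alpha> * D = \<eta> * a * b - f * e" "\<beta> * D = f * b + a * e"
      using that D by (auto simp: D_def)
    have "(\<alpha> * a + \<beta> * f) * D = a * (\<alpha> * D) + f * (\<beta> * D)"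
      by (simp add: algebra_simps)
    also have "\<dots> = b * D"
      unfolding \<alpha>\<beta> by (simp add: D_def power2_eq_square algebra_simps)
    finally have b: "\<alpha> * a + \<beta> * f = b"
      using D by simp
    have "(\<eta> * \<beta> * a - \<alpha> * f) * D = \<eta> * a * (\<beta> * D) - f * (\<alpha> * D)"
      by (simp add: algebra_simps)
    also have "\<dots> = e * D"
      unfolding \<alpha>\<beta> by (simp add: D_def power2_eq_square algebra_simps)
    finally show ?thesis
      using D b by simp
  qed
qed

lemma L0star_eq_Union_K:
  assumes "\<not> is_square (- \<eta>)"
  shows "L0star = (\<Union>(\<alpha>, \<beta>). K \<eta> \<alpha> \<beta>)"
proof
  show "L0star \<subseteq> (\<Union>(\<alpha>, \<beta>). K \<eta> \<alpha> \<beta>)"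
  proof
    fix x :: "'a mod_ring mat" assume "x \<in> L0star"
    then obtain a b c e f where x: "x = tuple_mat a b c 0 e f" and af: "(a, f) \<noteq> (0, 0)"
      unfolding L0star_def by blast
    obtain \<alpha> \<beta> where "\<alpha> * a + \<beta> * f = b \<and> \<eta> * \<beta> * a - \<alpha> * f = e"
      using K_parameters_unique[OF assms af] by blast
    then have "x \<in> K \<eta> \<alpha> \<beta>"
      using af by (simp add: x tuple_mat_mem_K_iff)
    then show "x \<in> (\<Union>(\<alpha>, \<beta>). K \<eta> \<alpha> \<beta>)" by blast
  qed
  show "(\<Union>(\<alpha>, \<beta>). K \<eta> \<alpha> \<beta>) \<subseteq> L0star"
    using K_subset_L0star by fast
qed

lemma disjoint_family_K:
  assumes "\<not> is_square (- \<eta>)"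
  shows "disjoint_family (\<lambda>(\<alpha>, \<beta>). K \<eta> \<alpha> \<beta>)"
proof -
  have "\<alpha> = \<alpha>' \<and> \<beta> = \<beta>'" if x: "x \<in> K \<eta> \<alpha> \<beta>" "x \<in> K \<eta> \<alpha>' \<beta>'" for x \<alpha> \<beta> \<alpha>' \<beta>'
  proof -
    obtain a b c e f where "x = tuple_mat a b c 0 e f"
      using x(1) by (auto simp: K_def)
    with x show ?thesis
      by (metis tuple_mat_mem_K_iff K_parameters_unique[OF assms])
  qed
  then show ?thesis
    by (fastforce simp: disjoint_family_on_def)
qed

lemma card_K:
  fixes \<eta> \<alpha> \<beta> :: "'p :: prime_card mod_ring"
  shows "card (K \<eta> \<alpha> \<beta>) = CARD('p) ^ 3 - CARD('p)"
proof -
  let ?P = "UNIV - {(0, 0)} :: ('p mod_ring \<times> 'p mod_ring) set"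
  let ?g = "\<lambda>((a, f), c). tuple_mat a (\<alpha> * a + \<beta> * f) c 0 (\<eta> * \<beta> * a - \<alpha> * f) f"
  have "K \<eta> \<alpha> \<beta> = ?g ` (?P \<times> UNIV)"
    by (force simp: K_def image_def)
  moreover have "inj_on ?g (?P \<times> UNIV)"
    by (auto simp: inj_on_def tuple_mat_inject)
  ultimately have "card (K \<eta> \<alpha> \<beta>) = card (?P \<times> (UNIV :: 'p mod_ring set))"
    by (simp add: card_image)
  also have "\<dots> = (CARD('p) * CARD('p) - 1) * CARD('p)"
    by (simp add: card_cartesian_product card_Diff_singleton flip: UNIV_Times_UNIV)
  also have "\<dots> = CARD('p) ^ 3 - CARD('p)"
    by (simp add: diff_mult_distrib power3_eq_cube)
  finally show ?thesis .
qed

theorem theorem6p5: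
  fixes \<eta> :: "'p :: prime_card mod_ring"
  assumes "odd CARD('p)"
    and "\<not> is_square (- \<eta>)"
  shows "(\<forall>\<alpha> \<beta>. clique (commuting_graph (UT 4) \<restriction> L0star) (K \<eta> \<alpha> \<beta>)) \<and>
         disjoint_family (\<lambda>(\<alpha>, \<beta>). K \<eta> \<alpha> \<beta>) \<and>
         L0star \<subseteq> (\<Union>(\<alpha>, \<beta>). K \<eta> \<alpha> \<beta>) \<and>
         L0star = (\<Union>(\<alpha>, \<beta>). K \<eta> \<alpha> \<beta>) \<and>
         (\<forall>\<alpha> \<beta>. card (K \<eta> \<alpha> \<beta>) = CARD('p) ^ 3 - CARD('p))"
proof (intro conjI allI)
  show "clique (commuting_graph (UT 4) \<restriction> L0star) (K \<eta> \<alpha> \<beta>)" for \<alpha> \<beta>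
  proof (rule clique_induced_commuting_graphI[OF K_subset_L0star L0star_subset])
    show "x \<otimes>\<^bsub>UT 4\<^esub> y = y \<otimes>\<^bsub>UT 4\<^esub> x" if "x \<in> K \<eta> \<alpha> \<beta>" "y \<in> K \<eta> \<alpha> \<beta>" for x y
      using K_commute[OF that] by (simp add: UT_def)
  qed
  show "disjoint_family (\<lambda>(\<alpha>, \<beta>). K \<eta> \<alpha> \<beta>)"
    by (rule disjoint_family_K[OF assms(2)])
  show "L0star = (\<Union>(\<alpha>, \<beta>). K \<eta> \<alpha> \<beta>)"
    by (rule L0star_eq_Union_K[OF assms(2)])
  then show "L0star \<subseteq> (\<Union>(\<alpha>, \<beta>). K \<eta> \<alpha> \<beta>)"
    by simp
  show "card (K \<eta> \<alpha> \<beta>) = CARD('p) ^ 3 - CARD('p)" for \<alpha> \<beta>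
    by (rule card_K)
qed

end
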